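(* Let $\{A_0=I_n,A_1,A_2\}$ be the set of adjacency matrices of a non-symmetric association scheme with $2$ classes and order $n\ge5$. Let $\mathbf 1$ denote the all-one row vector of length $n$ and let $$C_1=\begin{bmatrix}0&\mathbf 1&0&0\\ 0&A_1&A_2&\mathbf 1^T\\ \mathbf 1^T&A_2&A_1&0\\ 0&0&\mathbf 1&0\end{bmatrix},$$ a square matrix of order $2(n+1)$. Let $$B=\begin{bmatrix}0&C_1\\ C_1^T&0\end{bmatrix}$$ be the adjacency matrix of an undirected graph $\Gamma$. Then $\Gamma$ is a connected bipartite amply regular graph with diameter $d=4$ and parameters $(v,k,\lambda,\mu)=\left(4(n+1),\,n,\,0,\,\frac{n-1}{2}\right)$, and $\Gamma$ is a $Q$-regular graph with distribution diagram $\mathcal Q_k$ (defined in the context) with $k=n$.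
   Context: All graphs are finite, simple and undirected unless stated otherwise. An association scheme with $m$ classes and order $n$ is given by non-zero $0/1$ matrices $A_0,\dots,A_m$ of order $n$ (its adjacency matrices) with $A_0=I$, $\sum_i A_i=J$ (all-ones matrix), $A_i^T\in\{A_0,\dots,A_m\}$ for all $i$, and each $A_iA_j$ a linear combination of $A_0,\dots,A_m$. It is non-symmetric if not all $A_i$ are symmetric. An amply regular graph with parameters $(v,k,\lambda,\mu)$ is a $k$-regular graph on $v$ vertices such that every pair of adjacent vertices has exactly $\lambda$ common neighbors and every pair of vertices at distance two has exactly $\mu$ common neighbors. A partition $\{B_1,\dots,B_r\}$ of $V(\Gamma)$ is equitable with quotient matrix $Q=(q_{ij})$ if every vertex of $B_i$ has exactly $q_{ij}$ neighbors in $B_j$, for all $i,j$. The distribution diagram of the partition records the sizes $|B_i|$ and the numbers $q_{ij}$ (it is used interchangeably with the quotient matrix). $\Gamma$ is $Q$-regular if for each vertex $x$ there is an equitable partition of $V(\Gamma)$ with quotient matrix $Q$ such that $\{x\}$ is a part. The distribution diagram $\mathcal Q_k$ has six cells $P_0,P_1,P_2,P_3,P_4,P_5$ of sizes $1,\ k,\ 2k,\ k,\ 1,\ 2$ respectively, with $P_0=\{x\}$, and with the following quotient numbers (all unlisted ones are $0$): $q_{01}=k$; $q_{10}=1$, $q_{12}=k-1$; $q_{21}=\frac{k-1}{2}$, $q_{23}=\frac{k-1}{2}$, $q_{25}=1$; $q_{32}=k-1$, $q_{34}=1$; $q_{43}=k$; $q_{52}=k$. *)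

theory Defs
  imports
    "Jordan_Normal_Form.Matrix"
    "Graph_Theory.Graph_Theory"
    "HOL-Library.Disjoint_Sets"
begin

text \<open>Association schemes. The adjacency matrices \<open>A\<^sub>0, \<dots>, A\<^sub>m\<close> are the values of \<open>A\<close> on
  \<open>{..m}\<close>; the other values of \<open>A\<close> are irrelevant.\<close>

definition association_scheme :: "nat \<Rightarrow> nat \<Rightarrow> (nat \<Rightarrow> real mat) \<Rightarrow> bool" where
  "association_scheme n m A \<longleftrightarrow>
     (\<forall>i\<le>m. A i \<in> carrier_mat n n \<and> A i \<noteq> 0\<^sub>m n n \<and>
            (\<forall>r<n. \<forall>c<n. A i $$ (r, c) \<in> {0, 1})) \<and>
     A 0 = 1\<^sub>m n \<and>
     (\<forall>r<n. \<forall>c<n. (\<Sum>i\<le>m. A i $$ (r, c)) = 1) \<and>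
     (\<forall>i\<le>m. transpose_mat (A i) \<in> A ` {..m}) \<and>
     (\<forall>i\<le>m. \<forall>j\<le>m. \<exists>p :: nat \<Rightarrow> real.
        A i * A j = mat n n (\<lambda>(r, c). \<Sum>l\<le>m. p l * A l $$ (r, c)))"

definition nonsymmetric_association_scheme :: "nat \<Rightarrow> nat \<Rightarrow> (nat \<Rightarrow> real mat) \<Rightarrow> bool" where
  "nonsymmetric_association_scheme n m A \<longleftrightarrow>
     association_scheme n m A \<and> (\<exists>i\<le>m. transpose_mat (A i) \<noteq> A i)"

text \<open>Graphs are symmetric loopfree finite digraphs (\<open>pair_graph\<close>); an edge is represented by its
  two arcs.\<close>

definition graph_of_adjacency_mat :: "real mat \<Rightarrow> nat pair_pre_digraph" where
  "graph_of_adjacency_mat B =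
     \<lparr> pverts = {..<dim_row B},
       parcs = {(i, j). i < dim_row B \<and> j < dim_col B \<and> B $$ (i, j) = 1} \<rparr>"

definition neighbors :: "'a pair_pre_digraph \<Rightarrow> 'a \<Rightarrow> 'a set" where
  "neighbors G x = {y. (x, y) \<in> parcs G}"

definition graph_dist :: "'a pair_pre_digraph \<Rightarrow> 'a \<Rightarrow> 'a \<Rightarrow> ereal" where
  "graph_dist G x y = wf_digraph.\<mu> (with_proj G) (\<lambda>_. 1) x y"

definition graph_diameter :: "'a pair_pre_digraph \<Rightarrow> ereal" where
  "graph_diameter G = (SUP x\<in>pverts G. SUP y\<in>pverts G. graph_dist G x y)"

definition connected_graph :: "'a pair_pre_digraph \<Rightarrow> bool" where
  "connected_graph G \<longleftrightarrow> pair_graph G \<and> Digraph_Component.connected (with_proj G)"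

definition bipartite_graph :: "'a pair_pre_digraph \<Rightarrow> bool" where
  "bipartite_graph G \<longleftrightarrow> pair_graph G \<and>
     (\<exists>U W. U \<union> W = pverts G \<and> U \<inter> W = {} \<and>
        (\<forall>(x, y)\<in>parcs G. x \<in> U \<and> y \<in> W \<or> x \<in> W \<and> y \<in> U))"

definition amply_regular_graph :: "'a pair_pre_digraph \<Rightarrow> nat \<Rightarrow> nat \<Rightarrow> nat \<Rightarrow> nat \<Rightarrow> bool" where
  "amply_regular_graph G v k l m \<longleftrightarrow> pair_graph G \<and>
     card (pverts G) = v \<and>
     (\<forall>x\<in>pverts G. card (neighbors G x) = k) \<and>
     (\<forall>(x, y)\<in>parcs G. card (neighbors G x \<inter> neighbors G y) = l) \<and>
     (\<forall>x\<in>pverts G. \<forall>y\<in>pverts G. graph_dist G x y = 2 \<longrightarrow>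
        card (neighbors G x \<inter> neighbors G y) = m)"

definition equitable_partition :: "'a pair_pre_digraph \<Rightarrow> real mat \<Rightarrow> 'a set list \<Rightarrow> bool" where
  "equitable_partition G Q P \<longleftrightarrow>
     Q \<in> carrier_mat (length P) (length P) \<and>
     distinct P \<and> partition_on (pverts G) (set P) \<and>
     (\<forall>i<length P. \<forall>j<length P. \<forall>x\<in>P ! i.
        real (card (neighbors G x \<inter> P ! j)) = Q $$ (i, j))"

definition Q_regular :: "'a pair_pre_digraph \<Rightarrow> real mat \<Rightarrow> bool" where
  "Q_regular G Q \<longleftrightarrow> pair_graph G \<and>
     (\<forall>x\<in>pverts G. \<exists>P. equitable_partition G Q P \<and> {x} \<in> set P)"

text \<open>A distribution diagram is given by the list of the cell sizes together with the quotient
  matrix.\<close>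

definition has_distribution_diagram ::
    "'a pair_pre_digraph \<Rightarrow> 'a set list \<Rightarrow> nat list \<times> real mat \<Rightarrow> bool" where
  "has_distribution_diagram G P D \<longleftrightarrow> equitable_partition G (snd D) P \<and> map card P = fst D"

definition diagram_sizes :: "nat \<Rightarrow> nat list" where
  "diagram_sizes k = [1, k, 2 * k, k, 1, 2]"

definition diagram_quotient :: "nat \<Rightarrow> real mat" where
  "diagram_quotient k = (let \<kappa> = real k in mat_of_rows_list 6
     [[0, \<kappa>,           0,     0,           0, 0],
      [1, 0,           \<kappa> - 1, 0,           0, 0],
      [0, (\<kappa> - 1) / 2, 0,     (\<kappa> - 1) / 2, 0, 1],
      [0, 0,           \<kappa> - 1, 0,           1, 0],
      [0, 0,           0,     \<kappa>,           0, 0],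
      [0, 0,           \<kappa>,     0,           0, 0]])"

definition ones_mat :: "nat \<Rightarrow> nat \<Rightarrow> real mat" where
  "ones_mat r c = mat r c (\<lambda>_. 1)"

text \<open>The four-by-four block matrix with block sizes \<open>1, n, n, 1\<close>, cut in the middle into four
  two-by-two block matrices.\<close>

definition C1_mat :: "nat \<Rightarrow> real mat \<Rightarrow> real mat \<Rightarrow> real mat" where
  "C1_mat n A1 A2 = four_block_mat
     (four_block_mat (0\<^sub>m 1 1) (ones_mat 1 n)
                     (0\<^sub>m n 1) A1)
     (four_block_mat (0\<^sub>m 1 n) (0\<^sub>m 1 1)
                     A2        (ones_mat n 1))
     (four_block_mat (ones_mat n 1) A2
                     (0\<^sub>m 1 1)      (0\<^sub>m 1 n))
     (four_block_mat A1             (0\<^sub>m n 1)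
                     (ones_mat 1 n) (0\<^sub>m 1 1))"

definition B_mat :: "nat \<Rightarrow> real mat \<Rightarrow> real mat \<Rightarrow> real mat" where
  "B_mat n A1 A2 = (let C = C1_mat n A1 A2; N = 2 * (n + 1) in
     four_block_mat (0\<^sub>m N N) C (transpose_mat C) (0\<^sub>m N N))"

end

theory Submission
  imports Defs
begin

text \<open>
  In a non-symmetric scheme with two classes, \<open>A\<^sub>2\<close> is the transpose of \<open>A\<^sub>1\<close>, and \<open>A\<^sub>1\<close> is the matrix of
  a doubly regular tournament. Hence two distinct rows of \<open>C\<^sub>1\<close> have disjoint supports if they form
  one of the antipodal pairs \<open>{0, 2n + 1}\<close>, \<open>{1 + i, n + 1 + i}\<close>, and otherwise have exactly
  \<open>(n - 1) / 2\<close> common ones; the same holds for the columns. So \<open>\<Gamma>\<close> is bipartite with an involution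
  \<open>antipode\<close> preserving the colour classes, and the cells of the diagram at \<open>x\<close> are \<open>x\<close>, the
  neighbours of \<open>x\<close>, the other vertices of the colour of \<open>x\<close>, the neighbours of the antipode, the
  antipode, and the two vertices missed by both neighbourhoods. All quotient numbers, the diameter
  and the parameters follow from \<open>n = 2 \<cdot> (n - 1) / 2 + 1\<close> and these intersection numbers.
\<close>

section \<open>Bipartite graphs with an antipodal involution: distances, parameters and
  cells\<close>

section \<open>Antipodal bipartite graphs\<close>

lemma (in pair_wf_digraph) graph_dist_le_length:
  "awalk x p y \<Longrightarrow> graph_dist G x y \<le> length p"
  using min_cost_le_walk_cost[of x p y "\<lambda>_. 1"]
  by (simp add: graph_dist_def awalk_cost_def sum_list_triv)

text \<open>The distance is an infimum of walk lengths, so a strict bound yields a walk at once,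
  without showing that the infimum is attained.\<close>

lemma (in pair_wf_digraph) graph_dist_less_iff:
  "graph_dist G x y < e \<longleftrightarrow> (\<exists>p. awalk x p y \<and> ereal (length p) < e)"
  by (simp add: graph_dist_def \<mu>_def INF_less_iff awalk_cost_def sum_list_triv)

lemma diagram_quotient_carrier: "diagram_quotient k \<in> carrier_mat 6 6"
  unfolding diagram_quotient_def Let_def mat_of_rows_list_def by (rule carrier_matI) simp_all

text \<open>Evaluating a whole row at once lets the six counts at a vertex be compared with it as a
  single list equation.\<close>

lemma diagram_quotient_row:
  assumes "i < 6"
  shows "map (\<lambda>j. diagram_quotient k $$ (i, j)) [0..<6] =
    [[0, real k, 0, 0, 0, 0],
     [1, 0, real k - 1, 0, 0, 0],
     [0, (real k - 1) / 2, 0, (real k - 1) / 2, 0, 1],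
     [0, 0, real k - 1, 0, 1, 0],
     [0, 0, 0, real k, 0, 0],
     [0, 0, real k, 0, 0, 0]] ! i"
proof -
  have "[0..<6] = [0, 1, 2, 3, 4, 5::nat]" by (simp add: upt_rec)
  moreover have "i \<in> {0, 1, 2, 3, 4, 5}" using assms by auto
  ultimately show ?thesis
    by (auto simp: diagram_quotient_def Let_def mat_of_rows_list_def)
qed

text \<open>Collects the facts from which every claim about the graph is derived: equal colour
  classes, an involution inside each, and for two vertices of one colour the intersection number
  \<open>0\<close> (antipodal) or \<open>m\<close> (otherwise).\<close>

locale antipodal_bipartite_graph = pair_graph G for G :: "'a pair_pre_digraph" +
  fixes colour :: "'a \<Rightarrow> bool" and antipode :: "'a \<Rightarrow> 'a" and k m :: nat
  assumes arc_colour: "(x, y) \<in> parcs G \<Longrightarrow> colour x \<noteq> colour y"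
    and card_colour: "card {x \<in> pverts G. colour x = b} = 2 * k + 2"
    and antipode_in: "x \<in> pverts G \<Longrightarrow> antipode x \<in> pverts G"
    and antipode_neq: "x \<in> pverts G \<Longrightarrow> antipode x \<noteq> x"
    and antipode_antipode: "x \<in> pverts G \<Longrightarrow> antipode (antipode x) = x"
    and colour_antipode: "x \<in> pverts G \<Longrightarrow> colour (antipode x) = colour x"
    and degree: "x \<in> pverts G \<Longrightarrow> card (neighbors G x) = k"
    and antipode_disjoint: "x \<in> pverts G \<Longrightarrow> neighbors G x \<inter> neighbors G (antipode x) = {}"
    and common_neighbors: "\<lbrakk>x \<in> pverts G; y \<in> pverts G; colour x = colour y; y \<noteq> x; y \<noteq> antipode x\<rbrakk>
      \<Longrightarrow> card (neighbors G x \<inter> neighbors G y) = m"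
    and k_eq: "k = 2 * m + 1"
    and m_pos: "m > 0"
begin

lemma neighbors_sym: "y \<in> neighbors G x \<longleftrightarrow> x \<in> neighbors G y"
  using pair_sym_arcs by (auto simp: neighbors_def symmetric_def sym_def)

lemma neighborsD: "y \<in> neighbors G x \<Longrightarrow> x \<in> pverts G \<and> y \<in> pverts G \<and> colour y = (\<not> colour x)"
  using arc_colour by (auto simp: neighbors_def dest: in_arcsD1 in_arcsD2)

lemma finite_neighbors: "finite (neighbors G x)"
  by (rule finite_subset[OF _ pair_finite_verts]) (auto dest: neighborsD)

lemma verts_nonempty: "pverts G \<noteq> {}"
  using card_colour[of True] by auto

lemma neighbors_nonempty: "x \<in> pverts G \<Longrightarrow> neighbors G x \<noteq> {}"
  using degree[of x] k_eq by auto

lemma bipartite: "bipartite_graph G"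
  unfolding bipartite_graph_def
proof (intro conjI exI)
  show "{x \<in> pverts G. colour x} \<union> {x \<in> pverts G. \<not> colour x} = pverts G" by auto
  show "\<forall>(x, y)\<in>parcs G. x \<in> {x \<in> pverts G. colour x} \<and> y \<in> {x \<in> pverts G. \<not> colour x} \<or>
      x \<in> {x \<in> pverts G. \<not> colour x} \<and> y \<in> {x \<in> pverts G. colour x}"
    using arc_colour by (auto dest: in_arcsD1 in_arcsD2)
qed (use pair_graph_axioms in auto)

subsection \<open>Distances\<close>

lemma awalk_Cons_neighbors:
  "awalk x (e # p) y \<longleftrightarrow> fst e = x \<and> snd e \<in> neighbors G x \<and> awalk (snd e) p y"
  by (cases e) (auto simp: awalk_Cons_iff neighbors_def)

text \<open>Since \<open>m > 0\<close>, a common neighbour serves as the midpoint; the antipode is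
  excluded because it has no common neighbour with \<open>x\<close>.\<close>

lemma walk_same_colour:
  assumes "x \<in> pverts G" "y \<in> pverts G" "colour x = colour y" "y \<noteq> antipode x"
  obtains p where "awalk x p y" "length p \<le> 2"
proof (cases "y = x")
  case True
  then show ?thesis using that[of "[]"] assms by (simp add: awalk_Nil_iff)
next
  case False
  then have "card (neighbors G x \<inter> neighbors G y) > 0"
    using common_neighbors assms m_pos by simp
  then obtain z where "z \<in> neighbors G x \<inter> neighbors G y"
    by (metis card_gt_0_iff ex_in_conv)
  then show ?thesis
    using that[of "[(x, z), (z, y)]"] assms neighbors_sym[of y z]
    by (simp add: awalk_Cons_neighbors awalk_Nil_iff)
qed

text \<open>As \<open>k > 1\<close>, some neighbour of \<open>y\<close> is not the antipode of
  \<open>x\<close>; it has the colour of \<open>x\<close> and is reached in at most two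
  steps.\<close>

lemma walk_other_colour:
  assumes x: "x \<in> pverts G" and y: "y \<in> pverts G" and c: "colour x \<noteq> colour y"
  obtains p where "awalk x p y" "length p \<le> 3"
proof -
  have "card (neighbors G y) > 1" using degree[OF y] k_eq m_pos by simp
  then have "\<not> neighbors G y \<subseteq> {antipode x}"
    using card_mono[of "{antipode x}" "neighbors G y"] by auto
  then obtain z where z: "z \<in> neighbors G y" "z \<noteq> antipode x" by auto
  then have "z \<in> pverts G" "colour x = colour z" using neighborsD c by auto
  then obtain p where p: "awalk x p z" "length p \<le> 2" using walk_same_colour x z by blast
  have "awalk z [(z, y)] y"
    using z(1) y neighbors_sym[of y z] by (simp add: awalk_Cons_neighbors awalk_Nil_iff)
  with p(1) have "awalk x (p @ [(z, y)]) y" by (rule awalk_appendI)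
  then show ?thesis by (rule that) (use p(2) in simp)
qed

text \<open>For equal colours, one arbitrary first step changes the colour and leaves at most three
  more.\<close>

lemma walk_length_le_4:
  assumes x: "x \<in> pverts G" and y: "y \<in> pverts G"
  obtains p where "awalk x p y" "length p \<le> 4"
proof -
  obtain z where z: "z \<in> neighbors G x" using neighbors_nonempty x by blast
  show ?thesis
  proof (cases "colour x = colour y")
    case True
    then have "z \<in> pverts G" "colour z \<noteq> colour y" using neighborsD[OF z] by auto
    then obtain p where p: "awalk z p y" "length p \<le> 3" using walk_other_colour y by blast
    then show ?thesis using that[of "(x, z) # p"] z by (simp add: awalk_Cons_neighbors)
  next
    case False
    then obtain p where "awalk x p y" "length p \<le> 3" using walk_other_colour x y by blast
    then show ?thesis using that by simp
  qed
qed

lemma connected: "connected_graph G"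
  unfolding connected_graph_def
proof
  have "strongly_connected (with_proj G)"
    by (intro strongly_connectedI) (simp_all add: verts_nonempty, metis reachable_awalk walk_length_le_4)
  \<comment> \<open>Library connectedness speaks of the symmetric closure, to which reachability
    carries over.\<close>
  then show "Digraph_Component.connected (with_proj G)"
    by (auto intro!: connectedI reachable_mk_symmetricI simp: strongly_connected_def)
qed (rule pair_graph)

text \<open>Odd lengths contradict the colouring, length two would give a common neighbour of an
  antipodal pair, and length zero a fixed point of \<open>antipode\<close>.\<close>

lemma walk_antipode_length_ge_4:
  assumes x: "x \<in> pverts G" and p: "awalk x p (antipode x)"
  shows "length p \<ge> 4"
proof (rule ccontr)
  assume "\<not> 4 \<le> length p"
  then consider "length p = 0" | "length p = 1" | "length p = 2" | "length p = 3" by linarith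
  then show False
  proof cases
    case 1
    then show False using p antipode_neq[OF x] by (simp add: awalk_Nil_iff)
  next
    case 2
    then have "antipode x \<in> neighbors G x"
      using p by (auto simp: length_Suc_conv awalk_Cons_neighbors awalk_Nil_iff)
    then show False using neighborsD colour_antipode[OF x] by blast
  next
    case 3
    then obtain y where "y \<in> neighbors G x" "antipode x \<in> neighbors G y"
      using p by (auto simp: length_Suc_conv numeral_eq_Suc awalk_Cons_neighbors awalk_Nil_iff)
    then show False using antipode_disjoint[OF x] neighbors_sym by blast
  next
    case 4
    then obtain y z where "y \<in> neighbors G x" "z \<in> neighbors G y" "antipode x \<in> neighbors G z"
      using p by (auto simp: length_Suc_conv numeral_eq_Suc awalk_Cons_neighbors awalk_Nil_iff)
    then show False using neighborsD colour_antipode[OF x] by blast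
  qed
qed

lemma diameter: "graph_diameter G = 4"
proof (rule antisym)
  show "graph_diameter G \<le> 4"
    unfolding graph_diameter_def
  proof (intro SUP_least)
    fix x y assume "x \<in> pverts G" "y \<in> pverts G"
    then obtain p where p: "awalk x p y" "length p \<le> 4" by (rule walk_length_le_4)
    from p(1) have "graph_dist G x y \<le> length p" by (rule graph_dist_le_length)
    also have "ereal (length p) \<le> ereal 4" using p(2) by simp
    finally show "graph_dist G x y \<le> 4" by simp
  qed
  obtain x where x: "x \<in> pverts G" using verts_nonempty by blast
  \<comment> \<open>An antipodal pair attains the diameter: a distance below 4 would produce a walk
    that is too short.\<close>
  have "\<not> graph_dist G x (antipode x) < ereal 4"
    using walk_antipode_length_ge_4[OF x] by (force simp: graph_dist_less_iff)
  then have "4 \<le> graph_dist G x (antipode x)" by simp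
  then show "4 \<le> graph_diameter G"
    unfolding graph_diameter_def using x antipode_in[OF x] by (meson SUP_upper2)
qed

lemma graph_dist_2_imp_common_neighbor:
  assumes "graph_dist G x y = 2"
  shows "x \<noteq> y \<and> neighbors G x \<inter> neighbors G y \<noteq> {}"
proof -
  \<comment> \<open>The strict bound supplies a walk of length at most 2; every walk has length at
    least the distance 2, so this one has exactly one inner vertex.\<close>
  have "graph_dist G x y < ereal 3" using assms by simp
  then obtain p where p: "awalk x p y" "length p < 3"
    unfolding graph_dist_less_iff by auto
  have ge: "length q \<ge> 2" if "awalk x q y" for q
  proof -
    have "ereal 2 \<le> ereal (length q)" using graph_dist_le_length[OF that] assms by simp
    then show ?thesis by simp
  qed
  then have "length p = 2" using p by fastforce
  then have "neighbors G x \<inter> neighbors G y \<noteq> {}"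
    using p(1) neighbors_sym
    by (auto simp: length_Suc_conv numeral_eq_Suc awalk_Cons_neighbors awalk_Nil_iff)
  moreover have "x \<noteq> y"
    using ge[of "[]"] p(1) by (auto simp: awalk_Nil_iff)
  ultimately show ?thesis by simp
qed

lemma amply_regular: "amply_regular_graph G (4 * (k + 1)) k 0 m"
  unfolding amply_regular_graph_def
proof (intro conjI ballI impI)
  show "pair_graph G" ..
  have "pverts G = {x \<in> pverts G. colour x = True} \<union> {x \<in> pverts G. colour x = False}" by auto
  also have "card \<dots> = (2 * k + 2) + (2 * k + 2)"
    using pair_finite_verts by (subst card_Un_disjoint) (auto simp only: card_colour, auto)
  finally show "card (pverts G) = 4 * (k + 1)" by simp
  show "case e of (x, y) \<Rightarrow> card (neighbors G x \<inter> neighbors G y) = 0" if "e \<in> parcs G" for e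
  proof (cases e)
    case (Pair x y)
    then have "neighbors G x \<inter> neighbors G y = {}"
      using that arc_colour[of x y] by (auto dest!: neighborsD)
    then show ?thesis using Pair by simp
  qed
  fix x y assume xy: "x \<in> pverts G" "y \<in> pverts G" "graph_dist G x y = 2"
  from graph_dist_2_imp_common_neighbor[OF xy(3)]
  have *: "x \<noteq> y" "neighbors G x \<inter> neighbors G y \<noteq> {}" by auto
  \<comment> \<open>The common neighbour both excludes the antipode and forces equal
    colours.\<close>
  then have "y \<noteq> antipode x" using antipode_disjoint xy by auto
  moreover have "colour x = colour y" using *(2) by (auto dest!: neighborsD)
  ultimately show "card (neighbors G x \<inter> neighbors G y) = m"
    using common_neighbors xy * by auto
qed (rule degree)

subsection \<open>The distribution diagram\<close>

definition rest :: "'a \<Rightarrow> 'a set" where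
  "rest x = {y \<in> pverts G. colour y = colour x} - {x, antipode x}"

definition missed :: "'a \<Rightarrow> 'a set" where
  "missed x = {y \<in> pverts G. colour y \<noteq> colour x} - neighbors G x - neighbors G (antipode x)"

text \<open>The order is that of the rows of \<open>diagram_quotient\<close>, so the list index is
  the cell number of the diagram.\<close>

definition cells :: "'a \<Rightarrow> 'a set list" where
  "cells x = [{x}, neighbors G x, rest x, neighbors G (antipode x), {antipode x}, missed x]"

lemma card_rest:
  assumes "x \<in> pverts G"
  shows "card (rest x) = 2 * k"
  unfolding rest_def
  using assms antipode_in antipode_neq[OF assms] colour_antipode card_colour[of "colour x"]
  by (subst card_Diff_subset) auto

text \<open>The opposite colour class has \<open>2 * k + 2\<close> vertices, and the two disjoint
  neighbourhoods take up \<open>2 * k\<close> of them.\<close>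

lemma card_missed:
  assumes x: "x \<in> pverts G"
  shows "card (missed x) = 2"
proof -
  have "missed x = {y \<in> pverts G. colour y = (\<not> colour x)} - (neighbors G x \<union> neighbors G (antipode x))"
    unfolding missed_def by auto
  also have "card \<dots> = 2 * k + 2 - card (neighbors G x \<union> neighbors G (antipode x))"
    using x colour_antipode[OF x] card_colour[of "\<not> colour x"] finite_neighbors
    by (subst card_Diff_subset) (auto dest: neighborsD)
  also have "card (neighbors G x \<union> neighbors G (antipode x)) = 2 * k"
    using x antipode_in antipode_disjoint degree finite_neighbors by (subst card_Un_disjoint) auto
  finally show ?thesis by simp
qed

lemma card_cells: "x \<in> pverts G \<Longrightarrow> map card (cells x) = diagram_sizes k"
  by (simp add: cells_def diagram_sizes_def degree antipode_in card_rest card_missed)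

text \<open>All neighbours of \<open>y\<close> lie in the opposite class, which splits into the
  cells 1, 3 and 5; two of the counts therefore determine the third.\<close>

lemma neighbors_cells_same_colour:
  assumes x: "x \<in> pverts G" and y: "y \<in> pverts G" "colour y = colour x"
  shows "neighbors G y \<inter> {x} = {}" "neighbors G y \<inter> rest x = {}" "neighbors G y \<inter> {antipode x} = {}"
    and "card (neighbors G y \<inter> missed x) =
      k - card (neighbors G y \<inter> neighbors G x) - card (neighbors G y \<inter> neighbors G (antipode x))"
proof -
  show "neighbors G y \<inter> {x} = {}" "neighbors G y \<inter> rest x = {}" "neighbors G y \<inter> {antipode x} = {}"
    using x y colour_antipode by (auto simp: rest_def dest!: neighborsD)
  have "neighbors G y \<inter> missed x =
      neighbors G y - (neighbors G y \<inter> neighbors G x \<union> neighbors G y \<inter> neighbors G (antipode x))"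
    using y by (auto simp: missed_def dest: neighborsD)
  also have "card \<dots> = k - card (neighbors G y \<inter> neighbors G x \<union> neighbors G y \<inter> neighbors G (antipode x))"
    using degree y finite_neighbors by (subst card_Diff_subset) auto
  also have "card (neighbors G y \<inter> neighbors G x \<union> neighbors G y \<inter> neighbors G (antipode x)) =
      card (neighbors G y \<inter> neighbors G x) + card (neighbors G y \<inter> neighbors G (antipode x))"
    using antipode_disjoint[OF x] finite_neighbors by (subst card_Un_disjoint) auto
  finally show "card (neighbors G y \<inter> missed x) =
      k - card (neighbors G y \<inter> neighbors G x) - card (neighbors G y \<inter> neighbors G (antipode x))"
    by simp
qed

text \<open>Here the neighbours of \<open>y\<close> lie in the class of \<open>x\<close>, split into
  the cells 0, 2 and 4; those outside \<open>rest x\<close> can only be \<open>x\<close> and its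
  antipode.\<close>

lemma neighbors_cells_other_colour:
  assumes x: "x \<in> pverts G" and y: "y \<in> pverts G" "colour y \<noteq> colour x"
  shows "neighbors G y \<inter> neighbors G x = {}" "neighbors G y \<inter> neighbors G (antipode x) = {}"
      "neighbors G y \<inter> missed x = {}"
    and "neighbors G y \<inter> {x} = (if y \<in> neighbors G x then {x} else {})"
    and "neighbors G y \<inter> {antipode x} = (if y \<in> neighbors G (antipode x) then {antipode x} else {})"
    and "card (neighbors G y \<inter> rest x) =
      k - of_bool (y \<in> neighbors G x) - of_bool (y \<in> neighbors G (antipode x))"
proof -
  show "neighbors G y \<inter> neighbors G x = {}" "neighbors G y \<inter> neighbors G (antipode x) = {}"
      "neighbors G y \<inter> missed x = {}"
    using x y colour_antipode by (auto simp: missed_def dest!: neighborsD)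
  show x1: "neighbors G y \<inter> {x} = (if y \<in> neighbors G x then {x} else {})"
    and x2: "neighbors G y \<inter> {antipode x} = (if y \<in> neighbors G (antipode x) then {antipode x} else {})"
    using neighbors_sym by auto
  have "neighbors G y \<inter> rest x = neighbors G y - (neighbors G y \<inter> {x} \<union> neighbors G y \<inter> {antipode x})"
    using y by (auto simp: rest_def dest: neighborsD)
  also have "card \<dots> = k - card (neighbors G y \<inter> {x} \<union> neighbors G y \<inter> {antipode x})"
    using degree y finite_neighbors by (subst card_Diff_subset) auto
  finally show "card (neighbors G y \<inter> rest x) =
      k - of_bool (y \<in> neighbors G x) - of_bool (y \<in> neighbors G (antipode x))"
    unfolding x1 x2 using antipode_neq[OF x] by auto
qed

lemma equitable_cells:
  assumes x: "x \<in> pverts G"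
  shows "equitable_partition G (diagram_quotient k) (cells x)"
  unfolding equitable_partition_def
proof (intro conjI)
  note x' = antipode_in[OF x] colour_antipode[OF x] antipode_neq[OF x]
  have len: "length (cells x) = 6" by (simp add: cells_def)
  then show "diagram_quotient k \<in> carrier_mat (length (cells x)) (length (cells x))"
    by (simp add: diagram_quotient_carrier)
  have ne: "c \<noteq> {}" if "c \<in> set (cells x)" for c
  proof -
    have "card c \<in> set (diagram_sizes k)" using that card_cells[OF x] by (metis list.set_map imageI)
    then show ?thesis using k_eq by (auto simp: diagram_sizes_def)
  qed
  \<comment> \<open>Disjointness is stated by index: as no cell is empty, it gives distinctness of
    the list as well as disjointness of the blocks.\<close>
  have disj: "disjoint_family_on (\<lambda>i. cells x ! i) {..<6}"
    using antipode_disjoint[OF x] x x'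
    by (simp add: numeral_eq_Suc disjoint_family_on_def lessThan_Suc cells_def rest_def missed_def)
      (blast dest: neighborsD)
  show dist: "distinct (cells x)"
    unfolding distinct_conv_nth len
  proof (intro allI impI notI)
    fix i j assume "i < 6" "j < 6" "i \<noteq> j" "cells x ! i = cells x ! j"
    then show False
      using disj ne[of "cells x ! i"] len by (force simp: disjoint_family_on_def)
  qed
  show "partition_on (pverts G) (set (cells x))"
  proof (rule partition_onI)
    show "\<Union> (set (cells x)) = pverts G"
      using x x' by (auto simp: cells_def rest_def missed_def dest: neighborsD)
    fix p q assume "p \<in> set (cells x)" "q \<in> set (cells x)" "p \<noteq> q"
    then obtain i j where "i < 6" "j < 6" "i \<noteq> j" "p = cells x ! i" "q = cells x ! j"
      by (metis in_set_conv_nth len)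
    then show "disjnt p q"
      using disj by (simp add: disjoint_family_on_def disjnt_def)
  qed (use ne in blast)
  \<comment> \<open>Such a \<open>y\<close> is neither \<open>x\<close> nor its antipode, so both
    counts are \<open>m\<close>; the remaining \<open>k - 2 * m = 1\<close> neighbour lies in
    \<open>missed x\<close>, as row 2 requires.\<close>
  have "card (neighbors G y \<inter> neighbors G x) = m" "card (neighbors G y \<inter> neighbors G (antipode x)) = m"
    if "y \<in> rest x" for y
    using that x x' common_neighbors[of x y] common_neighbors[of "antipode x" y] antipode_antipode[OF x]
    by (auto simp: rest_def Int_commute)
  note rest_meet = this
  show "\<forall>i<length (cells x). \<forall>j<length (cells x). \<forall>y\<in>cells x ! i.
      real (card (neighbors G y \<inter> cells x ! j)) = diagram_quotient k $$ (i, j)"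
  proof (intro allI impI ballI)
    fix i j y assume i: "i < length (cells x)" and j: "j < length (cells x)" and y: "y \<in> cells x ! i"
    have y_in: "y \<in> pverts G"
      using y i len x x' by (auto simp: cells_def rest_def missed_def less_Suc_eq numeral_eq_Suc dest: neighborsD)
    note same = neighbors_cells_same_colour[OF x y_in]
    note other = neighbors_cells_other_colour[OF x y_in]
    consider "i = 0" | "i = 1" | "i = 2" | "i = 3" | "i = 4" | "i = 5" using i len by linarith
    then have "map (\<lambda>c. real (card (neighbors G y \<inter> c))) (cells x) =
        map (\<lambda>j. diagram_quotient k $$ (i, j)) [0..<6]"
    proof cases
      case 1
      then have "y = x" using y by (simp add: cells_def)
      then show ?thesis
        using 1 same antipode_disjoint[OF x] degree[OF x] by (simp add: diagram_quotient_row cells_def)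
    next
      case 2
      then have "y \<in> neighbors G x" using y by (simp add: cells_def)
      moreover from this have "y \<notin> neighbors G (antipode x)" "colour y \<noteq> colour x"
        using antipode_disjoint[OF x] neighborsD by blast+
      ultimately show ?thesis
        using 2 other k_eq by (simp add: diagram_quotient_row cells_def)
    next
      case 3
      then have "y \<in> rest x" using y by (simp add: cells_def)
      moreover from this have "colour y = colour x" by (simp add: rest_def)
      ultimately show ?thesis
        using 3 same rest_meet[of y] k_eq by (simp add: diagram_quotient_row cells_def)
    next
      case 4
      then have "y \<in> neighbors G (antipode x)" using y by (simp add: cells_def)
      moreover from this have "y \<notin> neighbors G x" "colour y \<noteq> colour x"
        using antipode_disjoint[OF x] neighborsD x' by blast+
      ultimately show ?thesis
        using 4 other k_eq by (simp add: diagram_quotient_row cells_def)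
    next
      case 5
      then have "y = antipode x" using y by (simp add: cells_def)
      then show ?thesis
        using 5 same antipode_disjoint[OF x] degree[OF x'(1)] x'
        by (simp add: diagram_quotient_row cells_def Int_commute)
    next
      case 6
      then have "y \<in> missed x" using y by (simp add: cells_def)
      moreover from this have "y \<notin> neighbors G x" "y \<notin> neighbors G (antipode x)" "colour y \<noteq> colour x"
        by (auto simp: missed_def)
      ultimately show ?thesis
        using 6 other by (simp add: diagram_quotient_row cells_def)
    qed
    then have "map (\<lambda>c. real (card (neighbors G y \<inter> c))) (cells x) ! j =
        map (\<lambda>j. diagram_quotient k $$ (i, j)) [0..<6] ! j" by simp
    then show "real (card (neighbors G y \<inter> cells x ! j)) = diagram_quotient k $$ (i, j)"
      using j len by simp
  qed
qed

lemma distribution_diagram: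
  "x \<in> pverts G \<Longrightarrow> has_distribution_diagram G (cells x) (diagram_sizes k, diagram_quotient k)"
  by (simp add: has_distribution_diagram_def equitable_cells card_cells)

lemma Q_regular: "Q_regular G (diagram_quotient k)"
  unfolding Q_regular_def using equitable_cells by (force simp: cells_def)

end

section \<open>Doubly regular tournaments and their origin in non-symmetric two-class
  schemes\<close>

section \<open>Doubly regular tournaments\<close>

definition out_nbrs :: "nat \<Rightarrow> (nat \<Rightarrow> nat \<Rightarrow> bool) \<Rightarrow> nat \<Rightarrow> nat set" where
  "out_nbrs n T i = {j. j < n \<and> T i j}"

definition in_nbrs :: "nat \<Rightarrow> (nat \<Rightarrow> nat \<Rightarrow> bool) \<Rightarrow> nat \<Rightarrow> nat set" where
  "in_nbrs n T i = {j. j < n \<and> T j i}"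

text \<open>Here \<open>r\<close> is the common in- and out-degree and \<open>q\<close> the number
  of common out-neighbours, or in-neighbours, of two vertices; thus
  \<open>n = 4 * q + 3\<close>.\<close>

locale doubly_regular_tournament =
  fixes n r q :: nat and T :: "nat \<Rightarrow> nat \<Rightarrow> bool"
  assumes n_eq: "n = 2 * r + 1" and r_eq: "r = 2 * q + 1"
    and irrefl: "i < n \<Longrightarrow> \<not> T i i"
    and antisym: "\<lbrakk>i < n; j < n; i \<noteq> j\<rbrakk> \<Longrightarrow> T j i \<longleftrightarrow> \<not> T i j"
    and card_out: "i < n \<Longrightarrow> card (out_nbrs n T i) = r"
    and card_in: "i < n \<Longrightarrow> card (in_nbrs n T i) = r"
    and card_out_out: "\<lbrakk>i < n; j < n; i \<noteq> j\<rbrakk> \<Longrightarrow> card (out_nbrs n T i \<inter> out_nbrs n T j) = q"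
    and card_in_in: "\<lbrakk>i < n; j < n; i \<noteq> j\<rbrakk> \<Longrightarrow> card (in_nbrs n T i \<inter> in_nbrs n T j) = q"
begin

lemma nbrs_subset: "out_nbrs n T i \<subseteq> {..<n}" "in_nbrs n T i \<subseteq> {..<n}"
  by (auto simp: out_nbrs_def in_nbrs_def)

lemma out_in_disjoint: "i < n \<Longrightarrow> out_nbrs n T i \<inter> in_nbrs n T i = {}"
  using irrefl antisym by (fastforce simp: out_nbrs_def in_nbrs_def)

text \<open>Each of the \<open>r\<close> out-neighbours of \<open>i\<close> has an arc to
  \<open>j\<close>, has an arc from \<open>j\<close>, or is \<open>j\<close> itself. The additive
  form avoids truncated subtraction.\<close>

lemma card_out_in:
  assumes "i < n" "j < n" "i \<noteq> j"
  shows "card (out_nbrs n T i \<inter> in_nbrs n T j) + q + of_bool (T i j) = r"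
proof -
  have fin: "finite (out_nbrs n T i)" by (simp add: out_nbrs_def)
  have "out_nbrs n T i = (out_nbrs n T i \<inter> in_nbrs n T j) \<union> (out_nbrs n T i \<inter> out_nbrs n T j) \<union>
      (if T i j then {j} else {})"
    using assms antisym[of _ j] by (auto simp: out_nbrs_def in_nbrs_def)
  also have "card \<dots> = card (out_nbrs n T i \<inter> in_nbrs n T j) + card (out_nbrs n T i \<inter> out_nbrs n T j) +
      card (if T i j then {j} else {})"
    using out_in_disjoint[OF assms(2)] irrefl[OF assms(2)] fin
    by (subst card_Un_disjoint, (auto simp: out_nbrs_def in_nbrs_def)[3],
        subst card_Un_disjoint) auto
  finally show ?thesis using card_out[OF assms(1)] card_out_out[OF assms] by auto
qed

text \<open>Adding \<open>card_out_in\<close> for \<open>(i, j)\<close> and \<open>(j, i)\<close>,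
  where exactly one arc is present, gives \<open>2 * r - 2 * q - 1 = r\<close>.\<close>

lemma card_mixed:
  assumes "i < n" "j < n" "i \<noteq> j"
  shows "card (out_nbrs n T i \<inter> in_nbrs n T j) + card (in_nbrs n T i \<inter> out_nbrs n T j) = r"
  using card_out_in[OF assms] card_out_in[OF assms(2,1)] assms antisym[OF assms] r_eq
  by (auto simp: Int_commute)

end

text \<open>Bridge from the algebra of the scheme to counting: an entry of a product of 0/1 matrices
  is the size of an overlap of supports.\<close>

lemma scalar_prod_zero_one_rows:
  fixes M N :: "real mat"
  assumes "M \<in> carrier_mat n n" "N \<in> carrier_mat n n" "i < n" "j < n"
    and "\<And>l. l < n \<Longrightarrow> M $$ (i, l) = of_bool (P l)" "\<And>l. l < n \<Longrightarrow> N $$ (l, j) = of_bool (R l)"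
  shows "(M * N) $$ (i, j) = card ({l. l < n \<and> P l} \<inter> {l. l < n \<and> R l})"
proof -
  have "(M * N) $$ (i, j) = (\<Sum>l<n. of_bool (P l \<and> R l))"
    using assms by (simp add: scalar_prod_def atLeast0LessThan of_bool_conj)
  also have "\<dots> = card ({..<n} \<inter> {l. P l \<and> R l})" by (simp add: of_bool_def sum.If_cases)
  also have "{..<n} \<inter> {l. P l \<and> R l} = {l. l < n \<and> P l} \<inter> {l. l < n \<and> R l}" by auto
  finally show ?thesis .
qed

text \<open>Transposition must exchange \<open>A 1\<close> and \<open>A 2\<close>, so
  \<open>A 1\<close> is a tournament; the products \<open>A 1 * A 2\<close> and
  \<open>A 2 * A 1\<close> are symmetric, which makes the intersection sizes constant.\<close>

lemma scheme_imp_doubly_regular_tournament: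
  assumes scheme: "nonsymmetric_association_scheme n 2 A" and n: "n \<ge> 5"
  defines "T \<equiv> \<lambda>i j. A 1 $$ (i, j) = 1"
  obtains r q where "doubly_regular_tournament n r q T"
    and "\<And>i j. i < n \<Longrightarrow> j < n \<Longrightarrow> A 1 $$ (i, j) = of_bool (T i j)"
    and "\<And>i j. i < n \<Longrightarrow> j < n \<Longrightarrow> A 2 $$ (i, j) = of_bool (T j i)"
proof -
  have car: "A i \<in> carrier_mat n n" if "i \<le> 2" for i
    using scheme that by (simp add: nonsymmetric_association_scheme_def association_scheme_def)
  have A0: "A 0 = 1\<^sub>m n"
    using scheme by (simp add: nonsymmetric_association_scheme_def association_scheme_def)
  have zo: "A i $$ (s, t) \<in> {0, 1}" if "i \<le> 2" "s < n" "t < n" for i s t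
    using scheme that by (simp add: nonsymmetric_association_scheme_def association_scheme_def)
  have sum2: "(\<Sum>i\<le>2. A i $$ (s, t)) = 1" if "s < n" "t < n" for s t
    using scheme that by (simp add: nonsymmetric_association_scheme_def association_scheme_def)
  have sum1: "of_bool (s = t) + A 1 $$ (s, t) + A 2 $$ (s, t) = 1" if "s < n" "t < n" for s t
    using sum2[OF that] that A0 by (auto simp: numeral_2_eq_2 atMost_Suc)
  have "transpose_mat (A i) \<in> A ` {..2}" if "i \<le> 2" for i
    using scheme that by (simp add: nonsymmetric_association_scheme_def association_scheme_def)
  moreover have "{..2::nat} = {0, 1, 2}" by auto
  ultimately have tr: "transpose_mat (A i) \<in> {A 0, A 1, A 2}" if "i \<le> 2" for i
    using that by simp
  have prod: "\<exists>p :: nat \<Rightarrow> real. A i * A j = mat n n (\<lambda>(r, c). \<Sum>l\<le>2. p l * A l $$ (r, c))"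
    if "i \<le> 2" "j \<le> 2" for i j
    using scheme that by (simp add: nonsymmetric_association_scheme_def association_scheme_def)
  obtain i0 where i0: "i0 \<le> 2" "transpose_mat (A i0) \<noteq> A i0"
    using scheme by (auto simp: nonsymmetric_association_scheme_def)
  \<comment> \<open>Otherwise \<open>A i\<close> would be a second identity matrix, and the diagonal
    entries would sum to more than 1.\<close>
  have not_id: "transpose_mat (A i) \<noteq> A 0" if "i \<in> {1, 2}" for i
  proof
    assume "transpose_mat (A i) = A 0"
    then have "transpose_mat (transpose_mat (A i)) = 1\<^sub>m n" using A0 by simp
    then have "A i = 1\<^sub>m n" by simp
    then have "A i $$ (0, 0) = 1" using n by simp
    then show False using sum1[of 0 0] zo[of 1 0 0] zo[of 2 0 0] that n by auto
  qed
  have "i0 \<noteq> 0" using i0(2) A0 by auto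
  then have "i0 \<in> {1, 2}" using i0(1) by auto
  then have A2: "A 2 = transpose_mat (A 1)"
    using i0 tr[of i0] not_id[of i0] by (metis One_nat_def insertE singletonD transpose_transpose)
  have A1T: "A 1 $$ (i, j) = of_bool (T i j)" if "i < n" "j < n" for i j
    using zo[of 1 i j] that by (auto simp: T_def)
  have A2T: "A 2 $$ (i, j) = of_bool (T j i)" if "i < n" "j < n" for i j
    using A1T that car[of 1] by (simp add: A2 del: One_nat_def)
  have irrefl: "\<not> T i i" if "i < n" for i
    using sum1[OF that that] that by (simp add: A1T A2T del: One_nat_def split: if_splits)
  have antisym: "T j i \<longleftrightarrow> \<not> T i j" if "i < n" "j < n" "i \<noteq> j" for i j
    using sum1[of i j] that by (auto simp: A1T A2T of_bool_def simp del: One_nat_def split: if_splits)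
  have T_iff: "T 0 1 \<longleftrightarrow> \<not> T 1 0" using antisym[of 1 0] n by simp
  \<comment> \<open>A product that is symmetric as a matrix has equal coefficients at \<open>A 1\<close> and \<open>A 2 = (A 1)\<^sup>T\<close>.\<close>
  have const: "\<exists>a b. \<forall>i<n. \<forall>j<n. card (N i \<inter> N j) = (if i = j then a else b)"
    if N: "\<And>i j. i < n \<Longrightarrow> j < n \<Longrightarrow> (A s * A t) $$ (i, j) = real (card (N i \<inter> N j))" and st: "s \<le> 2" "t \<le> 2"
    for s t and N :: "nat \<Rightarrow> nat set"
  proof -
    obtain p :: "nat \<Rightarrow> real" where p: "A s * A t = mat n n (\<lambda>(r, c). \<Sum>l\<le>2. p l * A l $$ (r, c))"
      using prod st by blast
    have N_p: "real (card (N i \<inter> N j)) = (if i = j then p 0 else if T i j then p 1 else p 2)"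
      if "i < n" "j < n" for i j
      using N[OF that] that A0 irrefl[of i] antisym[of i j]
      by (auto simp: p numeral_2_eq_2 atMost_Suc A1T[unfolded One_nat_def] A2T[unfolded numeral_2_eq_2])
    have "p 1 = p 2"
      using N_p[of 0 1] N_p[of 1 0] n T_iff by (auto simp: Int_commute split: if_splits)
    then have "card (N i \<inter> N j) = (if i = j then card (N 0) else card (N 0 \<inter> N 1))"
      if "i < n" "j < n" for i j
      using N_p[OF that] N_p[of 0 0] N_p[of 0 1] n by (auto split: if_splits)
    then show ?thesis by blast
  qed
  let ?out = "out_nbrs n T" and ?in = "in_nbrs n T"
  \<comment> \<open>Column \<open>j\<close> of \<open>A 2\<close> is row \<open>j\<close> of
    \<open>A 1\<close>, so this product compares out-neighbourhoods and the reversed one compares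
    in-neighbourhoods.\<close>
  have "(A 1 * A 2) $$ (i, j) = card (?out i \<inter> ?out j)" if "i < n" "j < n" for i j
    unfolding out_nbrs_def using that car A1T A2T by (intro scalar_prod_zero_one_rows) auto
  from const[OF this] obtain r q where out: "\<And>i j. i < n \<Longrightarrow> j < n \<Longrightarrow> card (?out i \<inter> ?out j) = (if i = j then r else q)"
    by auto
  have "(A 2 * A 1) $$ (i, j) = card (?in i \<inter> ?in j)" if "i < n" "j < n" for i j
    unfolding in_nbrs_def using that car A1T A2T by (intro scalar_prod_zero_one_rows) auto
  from const[OF this] obtain r' q' where inn: "\<And>i j. i < n \<Longrightarrow> j < n \<Longrightarrow> card (?in i \<inter> ?in j) = (if i = j then r' else q')"
    by auto
  have card_out: "card (?out i) = r" if "i < n" for i using out[OF that that] by simp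
  have card_in: "card (?in i) = r'" if "i < n" for i using inn[OF that that] by simp
  \<comment> \<open>Counting all arcs by tail and by head gives
    \<open>n * r = n * r'\<close>.\<close>
  have "(\<Sum>i<n. card (?out i)) = (\<Sum>i<n. \<Sum>j<n. of_bool (T i j))"
    by (simp add: out_nbrs_def of_bool_def sum.If_cases Int_def)
  also have "\<dots> = (\<Sum>j<n. \<Sum>i<n. of_bool (T i j))" by (rule sum.swap)
  also have "\<dots> = (\<Sum>j<n. card (?in j))"
    by (simp add: in_nbrs_def of_bool_def sum.If_cases Int_def)
  finally have rr: "r' = r" using n by (simp add: card_out card_in)
  have asym0: "\<not> (T 0 j \<and> T j 0)" if "j < n" for j
    using irrefl[of 0] antisym[of 0 j] that n by (cases "j = 0") auto
  \<comment> \<open>Every other vertex is joined to vertex 0 by exactly one arc, whence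
    \<open>n - 1 = 2 * r\<close>.\<close>
  have "{..<n} - {0} = ?out 0 \<union> ?in 0"
    using irrefl[of 0] antisym[of 0] n by (auto simp: out_nbrs_def in_nbrs_def)
  moreover have "card (?out 0 \<union> ?in 0) = card (?out 0) + card (?in 0)"
    using asym0 by (intro card_Un_disjoint) (auto simp: out_nbrs_def in_nbrs_def)
  moreover have "card ({..<n} - {0}) = n - 1" using n by simp
  ultimately have n_eq: "n = 2 * r + 1" using card_out[of 0] card_in[of 0] rr n by simp
  \<comment> \<open>Counting pairs \<open>(j, l)\<close> with \<open>l \<in> N 0 \<inter> N j\<close> gives \<open>c + (n - 1) d = c\<^sup>2\<close>.\<close>
  have count: "c = 2 * d + 1"
    if N: "\<And>i j. i < n \<Longrightarrow> j < n \<Longrightarrow> card (N i \<inter> N j) = (if i = j then c else d)"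
      and N': "\<And>i. i < n \<Longrightarrow> card (N' i) = c" and c: "n = 2 * c + 1"
      and NN': "\<And>i. i < n \<Longrightarrow> N i = {j. j < n \<and> R i j}" "\<And>i. i < n \<Longrightarrow> N' i = {j. j < n \<and> R j i}"
    for c d N N' R
  proof -
    have "(\<Sum>j<n. card (N 0 \<inter> N j)) = (\<Sum>j<n. \<Sum>l\<in>N 0. of_bool (R j l))"
    proof (rule sum.cong)
      fix j assume "j \<in> {..<n}"
      then have "N 0 \<inter> N j = N 0 \<inter> {l. R j l}" using n NN'(1)[of 0] NN'(1)[of j] by auto
      then show "card (N 0 \<inter> N j) = (\<Sum>l\<in>N 0. of_bool (R j l))"
        using NN'(1)[of 0] n by (simp add: of_bool_def sum.If_cases)
    qed simp
    also have "\<dots> = (\<Sum>l\<in>N 0. \<Sum>j<n. of_bool (R j l))" by (rule sum.swap)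
    also have "\<dots> = (\<Sum>l\<in>N 0. c)"
    proof (rule sum.cong)
      fix l assume "l \<in> N 0"
      then have "l < n" using NN'(1)[of 0] n by auto
      then show "(\<Sum>j<n. of_bool (R j l)) = c"
        using N'[of l] NN'(2)[of l] by (simp add: of_bool_def sum.If_cases Int_def)
    qed simp
    also have "\<dots> = c * c" using N[of 0 0] n by simp
    also have "(\<Sum>j<n. card (N 0 \<inter> N j)) = (\<Sum>j<n. if 0 = j then c else d)"
      using N n by (intro sum.cong) auto
    \<comment> \<open>The term at 0 is \<open>c\<close>, and each of the remaining
      \<open>n - 1 = 2 * c\<close> terms is \<open>d\<close>; cancelling a factor \<open>c\<close>
      finishes the count.\<close>
    also have "\<dots> = c + 2 * c * d"
      using c by (simp add: sum.lessThan_Suc_shift del: sum.lessThan_Suc)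
    finally have "c * (2 * d + 1) = c * c" by (simp add: algebra_simps)
    moreover have "c > 0" using c n by simp
    ultimately show ?thesis by (metis mult_cancel1 less_not_refl)
  qed
  have r_eq: "r = 2 * q + 1"
    by (rule count[of ?out r q ?in T, OF out _ n_eq]) (use card_in rr in \<open>auto simp: out_nbrs_def in_nbrs_def\<close>)
  \<comment> \<open>The same count for the reversed tournament; both equations together force
    \<open>q' = q\<close>.\<close>
  have "r = 2 * q' + 1"
    by (rule count[of ?in r q' ?out "\<lambda>i j. T j i", OF _ _ n_eq])
      (use inn card_out rr in \<open>auto simp: out_nbrs_def in_nbrs_def\<close>)
  then have qq: "q' = q" using r_eq by simp
  have "doubly_regular_tournament n r q T"
  proof
    show "card (?in i) = r" if "i < n" for i using card_in[OF that] rr by simp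
    show "card (?out i \<inter> ?out j) = q" "card (?in i \<inter> ?in j) = q" if "i < n" "j < n" "i \<noteq> j" for i j
      using that out inn qq by simp_all
  qed (fact n_eq r_eq irrefl antisym card_out)+
  then show ?thesis using A1T A2T by (rule that)
qed

section \<open>Supports of the rows of \<open>C1_mat\<close> and their intersection numbers\<close>

section \<open>Rows of the block matrix\<close>

text \<open>A subset of the index set of \<open>C\<^sub>1\<close>, given by its traces on the blocks of sizes \<open>1, n, n, 1\<close>.\<close>

definition block_set :: "nat \<Rightarrow> bool \<Rightarrow> nat set \<Rightarrow> nat set \<Rightarrow> bool \<Rightarrow> nat set" where
  "block_set n a X Y d =
     (if a then {0} else {}) \<union> Suc ` X \<union> (\<lambda>i. n + 1 + i) ` Y \<union> (if d then {2 * n + 1} else {})"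

lemma card_block_set:
  assumes "X \<subseteq> {..<n}" "Y \<subseteq> {..<n}"
  shows "card (block_set n a X Y d) = of_bool a + card X + card Y + of_bool d"
proof -
  have fin: "finite X" "finite Y" using assms finite_subset by blast+
  let ?Y = "(\<lambda>i. n + 1 + i) ` Y" and ?a = "if a then {0::nat} else {}"
    and ?d = "if d then {2 * n + 1} else {}"
  have "card (block_set n a X Y d) = card (?a \<union> Suc ` X \<union> ?Y) + card ?d"
    unfolding block_set_def using fin assms by (intro card_Un_disjoint) auto
  also have "card (?a \<union> Suc ` X \<union> ?Y) = card (?a \<union> Suc ` X) + card ?Y"
    using fin assms by (intro card_Un_disjoint) auto
  also have "card (?a \<union> Suc ` X) = card ?a + card (Suc ` X)"
    using fin by (intro card_Un_disjoint) auto
  finally show ?thesis by (simp add: card_image inj_on_def)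
qed

lemma block_set_Int:
  assumes "X \<subseteq> {..<n}" "Y \<subseteq> {..<n}" "X' \<subseteq> {..<n}" "Y' \<subseteq> {..<n}"
  shows "block_set n a X Y d \<inter> block_set n a' X' Y' d' =
    block_set n (a \<and> a') (X \<inter> X') (Y \<inter> Y') (d \<and> d')"
  using assms by (auto simp: block_set_def split: if_splits)

lemma block_set_empty: "block_set n False {} {} False = {}"
  by (simp add: block_set_def)

text \<open>Exchanges the two outer indices and shifts between the two blocks of size
  \<open>n\<close>; the last branch sends \<open>2 * n + 1\<close> to \<open>0\<close>.\<close>

definition half_antipode :: "nat \<Rightarrow> nat \<Rightarrow> nat" where
  "half_antipode n x =
     (if x = 0 then 2 * n + 1 else if x \<le> n then x + n else if x \<le> 2 * n then x - n else 0)"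

lemma half_cases:
  assumes "x < 2 * n + 2"
  obtains (first) "x = 0" | (low) i where "i < n" "x = Suc i"
    | (high) i where "i < n" "x = n + 1 + i" | (last) "x = 2 * n + 1"
proof -
  have "x = 0 \<or> (x - 1 < n \<and> x = Suc (x - 1)) \<or> (x - (n + 1) < n \<and> x = n + 1 + (x - (n + 1))) \<or> x = 2 * n + 1"
    using assms by auto
  then show ?thesis using that by blast
qed

lemma half_antipode_simps:
  "half_antipode n 0 = 2 * n + 1" "i < n \<Longrightarrow> half_antipode n (Suc i) = n + 1 + i"
  "i < n \<Longrightarrow> half_antipode n (n + 1 + i) = Suc i" "half_antipode n (2 * n + 1) = 0"
  by (auto simp: half_antipode_def)

lemma half_antipode:
  assumes "x < 2 * n + 2"
  shows "half_antipode n x < 2 * n + 2" "half_antipode n x \<noteq> x" "half_antipode n (half_antipode n x) = x"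
  using assms by (auto simp: half_antipode_def)

text \<open>\<open>out_nbrs\<close> gives the rows of \<open>A1\<close>, and \<open>in_nbrs\<close>
  those of its transpose \<open>A2\<close>; the flags record the bordering ones.\<close>

definition row_support :: "nat \<Rightarrow> (nat \<Rightarrow> nat \<Rightarrow> bool) \<Rightarrow> nat \<Rightarrow> nat set" where
  "row_support n T x =
     (if x = 0 then block_set n False {..<n} {} False
      else if x \<le> n then block_set n False (out_nbrs n T (x - 1)) (in_nbrs n T (x - 1)) True
      else if x \<le> 2 * n then
        block_set n True (in_nbrs n T (x - (n + 1))) (out_nbrs n T (x - (n + 1))) False
      else block_set n False {} {..<n} False)"

lemma row_support_simps:
  "row_support n T 0 = block_set n False {..<n} {} False"
  "i < n \<Longrightarrow> row_support n T (Suc i) = block_set n False (out_nbrs n T i) (in_nbrs n T i) True"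
  "i < n \<Longrightarrow> row_support n T (n + 1 + i) = block_set n True (in_nbrs n T i) (out_nbrs n T i) False"
  "row_support n T (2 * n + 1) = block_set n False {} {..<n} False"
  by (auto simp: row_support_def)

context doubly_regular_tournament
begin

lemma row_support_subset: "row_support n T x \<subseteq> {..<2 * n + 2}"
  by (auto simp: row_support_def block_set_def out_nbrs_def in_nbrs_def split: if_splits)

lemma card_row_support:
  assumes "x < 2 * n + 2"
  shows "card (row_support n T x) = n"
  using assms
  by (cases rule: half_cases)
    (simp_all only: row_support_simps, simp_all add: card_block_set nbrs_subset card_in card_out,
     simp_all add: n_eq)

text \<open>In an antipodal pair of inner rows the roles of out- and in-neighbours of the same
  \<open>i\<close> are exchanged, and the bordering ones sit at opposite ends.\<close>

lemma row_support_antipode_disjoint: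
  assumes "x < 2 * n + 2"
  shows "row_support n T x \<inter> row_support n T (half_antipode n x) = {}"
  using assms
  by (cases rule: half_cases)
    (simp_all only: half_antipode_simps row_support_simps,
     simp_all add: block_set_Int nbrs_subset out_in_disjoint
       out_in_disjoint[unfolded Int_commute[of "out_nbrs n T _"]] block_set_empty)

text \<open>An outer row cuts out a neighbourhood of size \<open>r\<close>. Two rows of one inner
  block share \<open>q + q\<close> entries and one bordering one, \<open>r\<close> in total. Rows of
  different inner blocks are the case of \<open>card_mixed\<close>.\<close>

lemma card_row_support_Int:
  assumes "x < 2 * n + 2" "y < 2 * n + 2" "y \<noteq> x" "y \<noteq> half_antipode n x"
  shows "card (row_support n T x \<inter> row_support n T y) = r"
proof -
  note s = nbrs_subset
  have absorb: "{..<n} \<inter> out_nbrs n T i = out_nbrs n T i" "{..<n} \<inter> in_nbrs n T i = in_nbrs n T i"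
     "out_nbrs n T i \<inter> {..<n} = out_nbrs n T i" "in_nbrs n T i \<inter> {..<n} = in_nbrs n T i" for i
    using s by auto
  show ?thesis
    using assms(3,4)
    by (cases rule: half_cases[OF assms(1)]; cases rule: half_cases[OF assms(2)])
      (simp_all only: half_antipode_simps row_support_simps,
       simp_all add: block_set_Int card_block_set le_infI1 s absorb card_in card_out card_in_in card_out_out
         r_eq card_mixed[unfolded r_eq] card_mixed[unfolded r_eq Int_commute[of "out_nbrs n T _"]] Int_commute)
qed

end

section \<open>From rows and columns of \<open>C1_mat\<close> to neighbourhoods in the graph\<close>

section \<open>The graph of the block matrix\<close>

lemma B_mat_dim:
  assumes "A1 \<in> carrier_mat n n" "A2 \<in> carrier_mat n n"
  shows "dim_row (B_mat n A1 A2) = 2 * (2 * n + 2)" "dim_col (B_mat n A1 A2) = 2 * (2 * n + 2)"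
  using assms by (simp_all add: B_mat_def C1_mat_def Let_def ones_mat_def)

context doubly_regular_tournament
begin

text \<open>The columns of \<open>C\<^sub>1\<close> have the same supports as its rows, up to the antipodal map.\<close>

lemma row_support_transpose:
  assumes "x < 2 * n + 2" "y < 2 * n + 2"
  shows "x \<in> row_support n T (half_antipode n y) \<longleftrightarrow> y \<in> row_support n T x"
  by (cases rule: half_cases[OF assms(1)]; cases rule: half_cases[OF assms(2)])
    (simp_all only: half_antipode_simps row_support_simps,
     auto simp: block_set_def out_nbrs_def in_nbrs_def)

lemma C1_mat_eq_1_iff:
  assumes "A1 \<in> carrier_mat n n" "A2 \<in> carrier_mat n n"
    and "\<And>i j. i < n \<Longrightarrow> j < n \<Longrightarrow> A1 $$ (i, j) = of_bool (T i j)"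
    and "\<And>i j. i < n \<Longrightarrow> j < n \<Longrightarrow> A2 $$ (i, j) = of_bool (T j i)"
    and "x < 2 * n + 2" "y < 2 * n + 2"
  shows "C1_mat n A1 A2 $$ (x, y) = 1 \<longleftrightarrow> y \<in> row_support n T x"
  using assms(1-4)
  by (cases rule: half_cases[OF assms(5)]; cases rule: half_cases[OF assms(6)])
    (simp_all only: row_support_simps,
     auto simp: C1_mat_def ones_mat_def block_set_def out_nbrs_def in_nbrs_def)

end

locale tournament_block_graph = doubly_regular_tournament n r q T
  for n r q :: nat and T :: "nat \<Rightarrow> nat \<Rightarrow> bool" +
  fixes A1 A2 :: "real mat" and G :: "nat pair_pre_digraph"
  assumes A1_carrier: "A1 \<in> carrier_mat n n" and A2_carrier: "A2 \<in> carrier_mat n n"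
    and A1_T: "\<And>i j. i < n \<Longrightarrow> j < n \<Longrightarrow> A1 $$ (i, j) = of_bool (T i j)"
    and A2_T: "\<And>i j. i < n \<Longrightarrow> j < n \<Longrightarrow> A2 $$ (i, j) = of_bool (T j i)"
    and G_def: "G = graph_of_adjacency_mat (B_mat n A1 A2)"
begin

definition half :: nat where "half = 2 * n + 2"

lemma pverts_G: "pverts G = {..<2 * half}"
  using B_mat_dim[OF A1_carrier A2_carrier] by (simp add: G_def graph_of_adjacency_mat_def half_def)

lemma C1_dim: "C1_mat n A1 A2 \<in> carrier_mat half half"
  using A1_carrier A2_carrier by (intro carrier_matI) (simp_all add: C1_mat_def half_def ones_mat_def)

text \<open>Vertices below \<open>half\<close> are the rows of \<open>C1_mat\<close> and the others
  its columns, shifted by \<open>half\<close>; the second disjunct comes from the transposed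
  block.\<close>

lemma arc_iff:
  "(x, y) \<in> parcs G \<longleftrightarrow>
     (x < half \<and> half \<le> y \<and> y < 2 * half \<and> y - half \<in> row_support n T x) \<or>
     (half \<le> x \<and> x < 2 * half \<and> y < half \<and> x - half \<in> row_support n T y)"
proof -
  have B: "B_mat n A1 A2 = four_block_mat (0\<^sub>m half half) (C1_mat n A1 A2)
      (transpose_mat (C1_mat n A1 A2)) (0\<^sub>m half half)"
    by (simp add: B_mat_def half_def Let_def)
  have C: "C1_mat n A1 A2 $$ (u, v) = 1 \<longleftrightarrow> v \<in> row_support n T u" if "u < half" "v < half" for u v
    using C1_mat_eq_1_iff[OF A1_carrier A2_carrier A1_T A2_T] that by (simp add: half_def)
  show ?thesis
    using C1_dim by (auto simp: G_def graph_of_adjacency_mat_def B C split: if_splits)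
qed

lemma neighbors_low:
  assumes "x < half"
  shows "neighbors G x = (+) half ` row_support n T x"
proof (rule Set.set_eqI)
  fix y
  have "y \<in> (+) half ` row_support n T x \<longleftrightarrow> half \<le> y \<and> y - half \<in> row_support n T x"
    by (auto intro: image_eqI[of _ _ "y - half"])
  then show "y \<in> neighbors G x \<longleftrightarrow> y \<in> (+) half ` row_support n T x"
    using row_support_subset[of x] assms by (auto simp: neighbors_def arc_iff half_def)
qed

text \<open>The neighbourhood is a column support, which \<open>row_support_transpose\<close>
  rewrites as the support of the antipodal row; hence the facts about rows also cover
  columns.\<close>

lemma neighbors_high:
  assumes "x < half"
  shows "neighbors G (half + x) = row_support n T (half_antipode n x)"
proof (rule Set.set_eqI)
  fix y
  have "y \<in> neighbors G (half + x) \<longleftrightarrow> y < half \<and> x \<in> row_support n T y"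
    using assms by (auto simp: neighbors_def arc_iff)
  also have "\<dots> \<longleftrightarrow> y \<in> row_support n T (half_antipode n x)"
    using row_support_transpose[of y x, folded half_def] assms
      row_support_subset[of "half_antipode n x", folded half_def] by blast
  finally show "y \<in> neighbors G (half + x) \<longleftrightarrow> y \<in> row_support n T (half_antipode n x)" .
qed

definition antipode :: "nat \<Rightarrow> nat" where
  "antipode x = (if x < half then half_antipode n x else half + half_antipode n (x - half))"

lemma antipodal_bipartite:
  "antipodal_bipartite_graph G (\<lambda>x. x < half) antipode n r"
proof
  note ha = half_antipode[where n = n, folded half_def]
  have high: "\<exists>z<half. x = half + z" if "x \<in> pverts G" "\<not> x < half" for x
    using that by (intro exI[of _ "x - half"]) (auto simp: pverts_G)
  have arcs: "parcs G \<subseteq> pverts G \<times> pverts G" by (auto simp: arc_iff pverts_G)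
  show "fst e \<in> pverts G" "snd e \<in> pverts G" if "e \<in> parcs G" for e
    using that arcs by auto
  show "finite (pverts G)" by (simp add: pverts_G)
  then show "finite (parcs G)" using arcs by (meson finite_SigmaI finite_subset)
  show "fst e \<noteq> snd e" if "e \<in> parcs G" for e
    using that by (cases e) (auto simp: arc_iff)
  show "symmetric (with_proj G)"
    by (auto simp: symmetric_def arc_iff intro!: symI)
  show "(x < half) \<noteq> (y < half)" if "(x, y) \<in> parcs G" for x y
    using that by (auto simp: arc_iff)
  have "{x \<in> pverts G. (x < half) = b} = (if b then {..<half} else {half..<2 * half})" for b
    by (auto simp: pverts_G)
  then show "card {x \<in> pverts G. (x < half) = b} = 2 * n + 2" for b
    by (simp add: half_def)
  show "r > 0" using r_eq by simp
  show "n = 2 * r + 1" by (rule n_eq)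
  fix x assume x: "x \<in> pverts G"
  then have x': "\<not> x < half \<Longrightarrow> x - half < half" by (auto simp: pverts_G)
  show "antipode x \<in> pverts G" "antipode x \<noteq> x" "antipode (antipode x) = x" "(antipode x < half) = (x < half)"
    using ha[of x] ha[of "x - half"] x' by (auto simp: antipode_def pverts_G)
  show "card (neighbors G x) = n"
  proof (cases "x < half")
    case True
    then show ?thesis
      using card_row_support[of x, folded half_def] by (simp add: neighbors_low card_image)
  next
    case False
    then obtain z where "z < half" "x = half + z" using high x by blast
    then show ?thesis using card_row_support[of "half_antipode n z", folded half_def] ha[of z]
      by (simp add: neighbors_high)
  qed
  show "neighbors G x \<inter> neighbors G (antipode x) = {}"
  proof (cases "x < half")
    case True
    then have "neighbors G x \<inter> neighbors G (antipode x) =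
        (+) half ` (row_support n T x \<inter> row_support n T (half_antipode n x))"
      using ha[of x] by (simp add: antipode_def neighbors_low image_Int)
    then show ?thesis using True row_support_antipode_disjoint[of x, folded half_def] by simp
  next
    case False
    then obtain z where z: "z < half" "x = half + z" using high x by blast
    \<comment> \<open>By involutivity the two column supports are those of row
      \<open>half_antipode n z\<close> and of its own antipode \<open>z\<close>.\<close>
    then show ?thesis
      using row_support_antipode_disjoint[of "half_antipode n z", folded half_def] ha[of z]
      by (simp add: antipode_def neighbors_high)
  qed
  fix y assume y: "y \<in> pverts G" "(x < half) = (y < half)" "y \<noteq> x" "y \<noteq> antipode x"
  show "card (neighbors G x \<inter> neighbors G y) = r"
  proof (cases "x < half")
    case True
    then have "neighbors G x \<inter> neighbors G y = (+) half ` (row_support n T x \<inter> row_support n T y)"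
      using y by (simp add: neighbors_low image_Int)
    then show ?thesis
      using True y card_row_support_Int[of x y, folded half_def] by (simp add: card_image antipode_def)
  next
    case False
    then obtain z where z: "z < half" "x = half + z" using high x by blast
    obtain w where w: "w < half" "y = half + w" using False y high by blast
    \<comment> \<open>An involution is injective, so distinct columns correspond to distinct rows;
      the next fact says that these rows are not antipodal.\<close>
    have "half_antipode n w \<noteq> half_antipode n z" using ha(3) z w y(3) by metis
    moreover have "half_antipode n w \<noteq> z"
      using ha(3)[of w] z w y(4) by (auto simp: antipode_def)
    ultimately show ?thesis
      using card_row_support_Int[of "half_antipode n z" "half_antipode n w", folded half_def] ha[of z] ha[of w] z w
      by (simp add: neighbors_high)
  qed
qed

end

theorem proposition3p2:
  fixes n :: nat and A :: "nat \<Rightarrow> real mat" and \<Gamma> :: "nat pair_pre_digraph"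
  assumes "nonsymmetric_association_scheme n 2 A"
    and "n \<ge> 5"
    and "\<Gamma> = graph_of_adjacency_mat (B_mat n (A 1) (A 2))"
  shows "pair_graph \<Gamma> \<and> connected_graph \<Gamma> \<and> bipartite_graph \<Gamma> \<and>
    graph_diameter \<Gamma> = 4 \<and>
    (\<exists>\<mu> :: nat. real \<mu> = (real n - 1) / 2 \<and> amply_regular_graph \<Gamma> (4 * (n + 1)) n 0 \<mu>) \<and>
    Q_regular \<Gamma> (diagram_quotient n) \<and>
    (\<forall>x\<in>pverts \<Gamma>. \<exists>P. has_distribution_diagram \<Gamma> P (diagram_sizes n, diagram_quotient n) \<and>
       P ! 0 = {x})"
proof -
  obtain r q where T: "doubly_regular_tournament n r q (\<lambda>i j. A 1 $$ (i, j) = 1)"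
    and A1: "\<And>i j. i < n \<Longrightarrow> j < n \<Longrightarrow> A 1 $$ (i, j) = of_bool (A 1 $$ (i, j) = 1)"
    and A2: "\<And>i j. i < n \<Longrightarrow> j < n \<Longrightarrow> A 2 $$ (i, j) = of_bool (A 1 $$ (j, i) = 1)"
    using scheme_imp_doubly_regular_tournament[OF assms(1,2)] by blast
  have "A 1 \<in> carrier_mat n n" "A 2 \<in> carrier_mat n n"
    using assms(1) by (simp_all add: nonsymmetric_association_scheme_def association_scheme_def)
  then have "tournament_block_graph n r q (\<lambda>i j. A 1 $$ (i, j) = 1) (A 1) (A 2) \<Gamma>"
    using T A1 A2 assms(3) by (intro tournament_block_graph.intro tournament_block_graph_axioms.intro)
  then interpret antipodal_bipartite_graph \<Gamma> "\<lambda>x. x < tournament_block_graph.half n"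
      "tournament_block_graph.antipode n" n r
    by (rule tournament_block_graph.antipodal_bipartite)
  \<comment> \<open>The degree \<open>r\<close> of the tournament is the natural number behind the
    fraction, since \<open>n = 2 * r + 1\<close>.\<close>
  have "real r = (real n - 1) / 2" using k_eq by simp
  moreover have "\<exists>P. has_distribution_diagram \<Gamma> P (diagram_sizes n, diagram_quotient n) \<and> P ! 0 = {x}"
    if "x \<in> pverts \<Gamma>" for x
    using distribution_diagram[OF that] by (intro exI[of _ "cells x"]) (simp add: cells_def)
  ultimately show ?thesis
    using pair_graph connected bipartite diameter amply_regular Q_regular by blast
qed

end
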